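(* Let $A_0\in\mathbb{C}^{n\times n}$ have a simple eigenvalue $\lambda_0$ with right eigenvector $x_0\neq 0$ (so $A_0x_0=\lambda_0x_0$) and left eigenvector $y_0\neq 0$ (so $y_0^*A_0=\lambda_0y_0^*$), normalized so that $y_0^*x_0=1$. Let $\tau_0\in\mathbb{C}$ and let $A(\tau)\in\mathbb{C}^{n\times n}$ be a matrix-valued function of a complex parameter $\tau$ that is analytic in a neighborhood of $\tau_0$ and satisfies $A(\tau_0)=A_0$. Then $A(\tau)$ has a unique eigenvalue $\lambda(\tau)$ that is analytic in a neighborhood of $\tau_0$ with $\lambda(\tau_0)=\lambda_0$ (i.e. on some neighborhood of $\tau_0$ there is a unique analytic function $\lambda$ with $\lambda(\tau_0)=\lambda_0$ such that $\lambda(\tau)$ is an eigenvalue of $A(\tau)$ for every $\tau$ in that neighborhood), and $$\lambda'(\tau_0)=y_0^*A'(\tau_0)x_0,$$ where $\lambda'(\tau_0)$ and $A'(\tau_0)$ are the derivatives of $\lambda(\tau)$ and $A(\tau)$ at $\tau=\tau_0$.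
   Context: The superscript $*$ denotes complex conjugate transpose. An eigenvalue is simple if its algebraic multiplicity (its multiplicity as a root of the characteristic polynomial) is one. A matrix function $A(\tau)$ is analytic if each of its entries is analytic (complex differentiable) in $\tau$ in a neighborhood of $\tau_0$. *)

theory Defs
  imports "HOL-Complex_Analysis.Complex_Analysis" "Jordan_Normal_Form.Char_Poly"
begin

definition simple_eigenvalue :: "complex mat \<Rightarrow> complex \<Rightarrow> bool" where
  "simple_eigenvalue A k \<longleftrightarrow> eigenvalue A k \<and> order k (char_poly A) = 1"

text \<open>The row vector \<open>mat_of_row (conjugate y)\<close> is the conjugate transpose of the column
  vector \<open>y\<close>. The eigenvalue itself is not conjugated.\<close>

definition left_eigenvector :: "complex mat \<Rightarrow> complex vec \<Rightarrow> complex \<Rightarrow> bool" where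
  "left_eigenvector A y k \<longleftrightarrow>
     y \<in> carrier_vec (dim_row A) \<and> y \<noteq> 0\<^sub>v (dim_row A) \<and>
     mat_of_row (conjugate y) * A = k \<cdot>\<^sub>m mat_of_row (conjugate y)"

definition mat_analytic_on :: "nat \<Rightarrow> (complex \<Rightarrow> complex mat) \<Rightarrow> complex set \<Rightarrow> bool" where
  "mat_analytic_on n A U \<longleftrightarrow>
     (\<forall>t\<in>U. A t \<in> carrier_mat n n) \<and>
     (\<forall>i<n. \<forall>j<n. (\<lambda>t. A t $$ (i, j)) analytic_on U)"

definition mat_deriv :: "(complex \<Rightarrow> complex mat) \<Rightarrow> complex \<Rightarrow> complex mat" where
  "mat_deriv A t =
     mat (dim_row (A t)) (dim_col (A t)) (\<lambda>(i, j). deriv (\<lambda>s. A s $$ (i, j)) t)"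

definition analytic_eigenvalue_on ::
    "(complex \<Rightarrow> complex mat) \<Rightarrow> complex set \<Rightarrow> (complex \<Rightarrow> complex) \<Rightarrow> bool" where
  "analytic_eigenvalue_on A V l \<longleftrightarrow>
     l analytic_on V \<and> (\<forall>t\<in>V. eigenvalue (A t) (l t))"

end

theory Submission
  imports Defs
begin

text \<open>
  The eigenvalues of \<open>A t\<close> are the roots of \<open>p(z, t) = det (z I - A t)\<close>, a monic polynomial
  in \<open>z\<close> whose coefficients are holomorphic in \<open>t\<close>. At \<open>\<tau>\<close> the root \<open>\<lambda>\<close> is simple, so
  \<open>c = \<partial>p/\<partial>z\<close> does not vanish there, and for \<open>t\<close> near \<open>\<tau>\<close> the simplified Newton map
  \<open>z \<mapsto> z - p(z, t) / c\<close> contracts a small disc around \<open>\<lambda>\<close> into itself. Its fixed point is the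
  only root in the disc. The iterates starting from \<open>\<lambda>\<close> are holomorphic in \<open>t\<close> and converge
  uniformly, so the fixed point is holomorphic in \<open>t\<close>: this is \<open>holomorphic_simple_root\<close>. A
  competing analytic eigenvalue through \<open>\<lambda>\<close> stays inside the disc near \<open>\<tau>\<close>, hence agrees
  with the fixed point there, and then on the whole ball by analytic continuation.

  The derivative formula (\<open>eigenvalue_deriv\<close>) uses the vector \<open>w(t) = adj (l(t) I - A t) x\<close>,
  which is holomorphic because its entries are polynomial in \<open>l(t)\<close> and the entries of \<open>A t\<close>. It
  satisfies \<open>(l(t) I - A t) w(t) = p(l(t), t) x = 0\<close>, so the scalar
  \<open>(y\<^sup>* (l(t) I - A t)) w(t)\<close> vanishes identically. At \<open>\<tau>\<close> its first factor
  is zero since \<open>y\<close> is a left eigenvector, so differentiating leaves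
  \<open>y\<^sup>* (l'(\<tau>) I - A'(\<tau>)) w(\<tau>) = 0\<close>. Finally \<open>w(\<tau>) = c x\<close> with the same \<open>c \<noteq> 0\<close>
  (\<open>adj_char_poly_vec_eigenvector\<close>), which can be cancelled. The adjugate thus supplies a
  holomorphic eigenvector through a multiple of \<open>x\<close>, and it is this that makes the
  eigenvector equation differentiable.
\<close>

(* Leaves "$" to the entries of vectors. *)
no_notation fps_nth (infixl "$" 75)

section \<open>Polynomials with holomorphic coefficients\<close>

text \<open>The uniform degree bound turns the evaluation into one finite sum of holomorphic functions
  over all of \<open>S\<close>. Coefficientwise holomorphy alone would allow degrees that are unbounded
  on \<open>S\<close>.\<close>
definition holomorphic_poly_on :: "(complex \<Rightarrow> complex poly) \<Rightarrow> complex set \<Rightarrow> bool" where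
  "holomorphic_poly_on P S \<longleftrightarrow>
     (\<forall>i. (\<lambda>t. coeff (P t) i) holomorphic_on S) \<and> (\<exists>N. \<forall>t\<in>S. degree (P t) \<le> N)"

lemma holomorphic_poly_on_const: "holomorphic_poly_on (\<lambda>_. p) S"
  unfolding holomorphic_poly_on_def by auto

lemma holomorphic_poly_on_const_poly:
  assumes "f holomorphic_on S"
  shows "holomorphic_poly_on (\<lambda>t. [:f t:]) S"
proof -
  have "(\<lambda>t. coeff [:f t:] i) holomorphic_on S" for i
    using assms by (cases i) auto
  then show ?thesis unfolding holomorphic_poly_on_def by auto
qed

lemma holomorphic_poly_on_add:
  assumes "holomorphic_poly_on P S" "holomorphic_poly_on Q S"
  shows "holomorphic_poly_on (\<lambda>t. P t + Q t) S"
proof -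
  from assms obtain N M where N: "\<forall>t\<in>S. degree (P t) \<le> N" and M: "\<forall>t\<in>S. degree (Q t) \<le> M"
    unfolding holomorphic_poly_on_def by blast
  have "\<forall>t\<in>S. degree (P t + Q t) \<le> max N M"
    using N M by (meson degree_add_le max.coboundedI1 max.coboundedI2)
  with assms show ?thesis
    unfolding holomorphic_poly_on_def by (auto intro!: holomorphic_intros)
qed

lemma holomorphic_poly_on_mult:
  assumes "holomorphic_poly_on P S" "holomorphic_poly_on Q S"
  shows "holomorphic_poly_on (\<lambda>t. P t * Q t) S"
proof -
  from assms obtain N M where N: "\<forall>t\<in>S. degree (P t) \<le> N" and M: "\<forall>t\<in>S. degree (Q t) \<le> M"
    unfolding holomorphic_poly_on_def by blast
  have "\<forall>t\<in>S. degree (P t * Q t) \<le> N + M"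
    using N M by (meson add_mono degree_mult_le order_trans)
  with assms show ?thesis
    unfolding holomorphic_poly_on_def coeff_mult by (auto intro!: holomorphic_intros)
qed

lemma holomorphic_poly_on_sum:
  assumes "\<And>i. i \<in> I \<Longrightarrow> holomorphic_poly_on (P i) S"
  shows "holomorphic_poly_on (\<lambda>t. \<Sum>i\<in>I. P i t) S"
  using assms
  by (induction I rule: infinite_finite_induct)
     (auto intro: holomorphic_poly_on_const holomorphic_poly_on_add)

lemma holomorphic_poly_on_prod:
  assumes "\<And>i. i \<in> I \<Longrightarrow> holomorphic_poly_on (P i) S"
  shows "holomorphic_poly_on (\<lambda>t. \<Prod>i\<in>I. P i t) S"
  using assms
  by (induction I rule: infinite_finite_induct)
     (auto intro: holomorphic_poly_on_const holomorphic_poly_on_mult)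

lemma holomorphic_poly_on_pderiv:
  assumes "holomorphic_poly_on P S"
  shows "holomorphic_poly_on (\<lambda>t. pderiv (P t)) S"
proof -
  from assms obtain N where N: "\<forall>t\<in>S. degree (P t) \<le> N"
    unfolding holomorphic_poly_on_def by blast
  then have "\<forall>t\<in>S. degree (pderiv (P t)) \<le> N"
    by (metis degree_pderiv diff_le_self le_trans)
  with assms show ?thesis
    unfolding holomorphic_poly_on_def coeff_pderiv by (auto intro!: holomorphic_intros)
qed

lemma holomorphic_poly_on_cong:
  assumes "\<And>t. t \<in> S \<Longrightarrow> P t = Q t"
  shows "holomorphic_poly_on P S \<longleftrightarrow> holomorphic_poly_on Q S"
proof -
  have "(\<lambda>t. coeff (P t) i) holomorphic_on S \<longleftrightarrow> (\<lambda>t. coeff (Q t) i) holomorphic_on S" for i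
    by (rule holomorphic_cong) (auto simp: assms)
  then show ?thesis
    unfolding holomorphic_poly_on_def using assms by auto
qed

text \<open>The closure properties above apply because the Leibniz formula writes a determinant as a
  finite sum of products of entries. The determinants are taken over the polynomial ring, so that
  the characteristic polynomial and the adjugate of \<open>z I - A t\<close> are covered for all \<open>z\<close>
  at once.\<close>

lemma holomorphic_poly_on_det:
  assumes carrier: "\<And>t. t \<in> S \<Longrightarrow> M t \<in> carrier_mat n n"
    and entries: "\<And>i j. i < n \<Longrightarrow> j < n \<Longrightarrow> holomorphic_poly_on (\<lambda>t. M t $$ (i, j)) S"
  shows "holomorphic_poly_on (\<lambda>t. det (M t)) S"
proof -
  have "holomorphic_poly_on
      (\<lambda>t. \<Sum>p | p permutes {0..<n}. signof p * (\<Prod>i = 0..<n. M t $$ (i, p i))) S"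
    by (intro holomorphic_poly_on_sum holomorphic_poly_on_mult holomorphic_poly_on_prod
          holomorphic_poly_on_const entries)
       (auto dest: permutes_in_image)
  then show ?thesis
    by (subst holomorphic_poly_on_cong[OF det_def'[OF carrier]])
qed

lemma holomorphic_poly_on_adj_mat:
  assumes carrier: "\<And>t. t \<in> S \<Longrightarrow> M t \<in> carrier_mat n n"
    and entries: "\<And>i j. i < n \<Longrightarrow> j < n \<Longrightarrow> holomorphic_poly_on (\<lambda>t. M t $$ (i, j)) S"
    and ij: "i < n" "j < n"
  shows "holomorphic_poly_on (\<lambda>t. adj_mat (M t) $$ (i, j)) S"
proof -
  have minor: "holomorphic_poly_on (\<lambda>t. det (mat_delete (M t) j i)) S"
  proof (rule holomorphic_poly_on_det[where n = "n - 1"])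
    show "mat_delete (M t) j i \<in> carrier_mat (n - 1) (n - 1)" if "t \<in> S" for t
      by (rule mat_delete_carrier[OF carrier[OF that]])
    fix a b assume ab: "a < n - 1" "b < n - 1"
    have "mat_delete (M t) j i $$ (a, b)
        = M t $$ (if a < j then a else Suc a, if b < i then b else Suc b)" if "t \<in> S" for t
      using carrier[OF that] ab unfolding mat_delete_def by auto
    moreover have "holomorphic_poly_on
        (\<lambda>t. M t $$ (if a < j then a else Suc a, if b < i then b else Suc b)) S"
      by (rule entries) (use ab in auto)
    ultimately show "holomorphic_poly_on (\<lambda>t. mat_delete (M t) j i $$ (a, b)) S"
      by (subst holomorphic_poly_on_cong)
  qed
  have "adj_mat (M t) $$ (i, j) = (-1) ^ (j + i) * det (mat_delete (M t) j i)" if "t \<in> S" for t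
    using carrier[OF that] ij unfolding adj_mat_def cofactor_def by auto
  then show ?thesis
    by (subst holomorphic_poly_on_cong)
       (auto intro: holomorphic_poly_on_mult holomorphic_poly_on_const minor)
qed

lemma holomorphic_poly_on_eval_sum:
  assumes "holomorphic_poly_on P S"
  obtains N where "\<And>t z. t \<in> S \<Longrightarrow> poly (P t) z = (\<Sum>i\<le>N. coeff (P t) i * z ^ i)"
proof -
  from assms obtain N where N: "\<forall>t\<in>S. degree (P t) \<le> N"
    unfolding holomorphic_poly_on_def by blast
  show ?thesis
  proof (rule that[of N])
    fix t z assume "t \<in> S"
    then show "poly (P t) z = (\<Sum>i\<le>N. coeff (P t) i * z ^ i)"
      using N unfolding poly_altdef
      by (intro sum.mono_neutral_left) (auto simp: coeff_eq_0)
  qed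
qed

lemma holomorphic_on_poly_compose:
  assumes P: "holomorphic_poly_on P S" and u: "u holomorphic_on T" and "T \<subseteq> S"
  shows "(\<lambda>t. poly (P t) (u t)) holomorphic_on T"
proof -
  obtain N where N: "\<And>t z. t \<in> S \<Longrightarrow> poly (P t) z = (\<Sum>i\<le>N. coeff (P t) i * z ^ i)"
    using P by (rule holomorphic_poly_on_eval_sum) blast
  have "(\<lambda>t. coeff (P t) i) holomorphic_on T" for i
    using P \<open>T \<subseteq> S\<close> unfolding holomorphic_poly_on_def by (meson holomorphic_on_subset)
  then have "(\<lambda>t. \<Sum>i\<le>N. coeff (P t) i * u t ^ i) holomorphic_on T"
    using u by (intro holomorphic_intros)
  then show ?thesis
    by (subst holomorphic_cong[OF refl N]) (use \<open>T \<subseteq> S\<close> in auto)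
qed

lemma continuous_on_poly_jointly:
  assumes P: "holomorphic_poly_on P S"
  shows "continuous_on (S \<times> UNIV) (\<lambda>w. poly (P (fst w)) (snd w))"
proof -
  obtain N where N: "\<And>t z. t \<in> S \<Longrightarrow> poly (P t) z = (\<Sum>i\<le>N. coeff (P t) i * z ^ i)"
    using P by (rule holomorphic_poly_on_eval_sum) blast
  have "continuous_on S (\<lambda>t. coeff (P t) i)" for i
    using P unfolding holomorphic_poly_on_def by (blast intro: holomorphic_on_imp_continuous_on)
  then have "continuous_on (S \<times> UNIV) (\<lambda>w. coeff (P (fst w)) i)" for i
    by (rule continuous_on_compose2) (auto intro: continuous_intros)
  then have "continuous_on (S \<times> UNIV) (\<lambda>w. \<Sum>i\<le>N. coeff (P (fst w)) i * snd w ^ i)"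
    by (intro continuous_intros)
  then show ?thesis
    by (rule continuous_on_eq) (auto simp: N)
qed

section \<open>Holomorphic continuation of a simple root\<close>

text \<open>An implicit function theorem obtained from the simplified Newton map
  \<open>z \<mapsto> z - P t z / c\<close>, with the slope \<open>c\<close> taken once and for all at the base point. Its derivative in \<open>z\<close>
  vanishes at the base point, so by joint continuity it is a contraction on a common disc for all
  nearby \<open>t\<close>. The disc of uniqueness does not depend on \<open>t\<close>, which is what lets any
  continuous root through \<open>a\<close> be compared with \<open>l\<close>.\<close>

theorem holomorphic_simple_root:
  fixes P :: "complex \<Rightarrow> complex poly"
  assumes S: "open S" "\<tau> \<in> S" and P: "holomorphic_poly_on P S"
    and root: "poly (P \<tau>) a = 0" and simple: "poly (pderiv (P \<tau>)) a \<noteq> 0"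
  obtains d r l where "d > 0" "r > 0" "ball \<tau> d \<subseteq> S" "l holomorphic_on ball \<tau> d" "l \<tau> = a"
    "\<And>t. t \<in> ball \<tau> d \<Longrightarrow> poly (P t) (l t) = 0"
    "\<And>t z. t \<in> ball \<tau> d \<Longrightarrow> z \<in> cball a r \<Longrightarrow> poly (P t) z = 0 \<Longrightarrow> z = l t"
proof -
  define c where "c = poly (pderiv (P \<tau>)) a"
  define g where "g t z = z - poly (P t) z / c" for t z
  have c: "c \<noteq> 0" using simple by (simp add: c_def)
  have fixpoint_iff: "g t z = z \<longleftrightarrow> poly (P t) z = 0" for t z
    using c by (simp add: g_def)

  \<comment> \<open>\<open>D (t, z)\<close> is the derivative of \<open>g t\<close> at \<open>z\<close>.\<close>
  define D where "D = (\<lambda>w. 1 - poly (pderiv (P (fst w))) (snd w) / c)"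
  have "continuous_on (S \<times> UNIV) D"
    unfolding D_def using c
    by (intro continuous_intros continuous_on_poly_jointly holomorphic_poly_on_pderiv P) auto
  then have "isCont D (\<tau>, a)"
    using S by (simp add: continuous_on_eq_continuous_at open_Times)
  moreover have "D (\<tau>, a) = 0" using c by (simp add: D_def c_def)
  ultimately have "(D \<longlongrightarrow> 0) (nhds (\<tau>, a))"
    by (metis isCont_def tendsto_at_iff_tendsto_nhds)
  then have "\<forall>\<^sub>F w in nhds (\<tau>, a). dist (D w) 0 < 1/2"
    by (rule tendstoD) simp
  then obtain e where e: "e > 0" "\<And>w. dist w (\<tau>, a) < e \<Longrightarrow> norm (D w) < 1/2"
    unfolding eventually_nhds_metric by auto
  define r where "r = e / 2"
  have r: "r > 0" using e by (simp add: r_def)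
  have D_bound: "norm (D (t, z)) \<le> 1/2" if "dist t \<tau> < r" "dist z a \<le> r" for t z
  proof -
    have "dist (t, z) (\<tau>, a) \<le> dist t \<tau> + dist z a"
      unfolding dist_Pair_Pair by (rule sqrt_sum_squares_le_sum) auto
    also have "\<dots> < e" using that by (simp add: r_def)
    finally show ?thesis using e(2) by fastforce
  qed
  have contraction: "dist (g t z) (g t w) \<le> 1/2 * dist z w"
    if t: "dist t \<tau> < r" and zw: "z \<in> cball a r" "w \<in> cball a r" for t z w
    unfolding dist_norm
  proof (rule field_differentiable_bound[where S = "cball a r" and f' = "\<lambda>z. D (t, z)"])
    fix z assume "z \<in> cball a r"
    then show "norm (D (t, z)) \<le> 1/2" using D_bound[OF t] by (simp add: dist_commute)
    show "(g t has_field_derivative D (t, z)) (at z within cball a r)"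
      unfolding g_def D_def using c by (auto intro!: derivative_eq_intros poly_DERIV)
  qed (use zw in auto)

  \<comment> \<open>The centre moves little for \<open>t\<close> near \<open>\<tau>\<close>, so the disc is mapped into itself.\<close>
  have "isCont (\<lambda>t. poly (P t) a) \<tau>"
    using holomorphic_on_poly_compose[OF P holomorphic_on_const[of a S] order_refl] S
    by (metis holomorphic_on_imp_continuous_on continuous_on_eq_continuous_at)
  then have "isCont (\<lambda>t. g t a) \<tau>"
    unfolding g_def using c by (intro continuous_intros) auto
  moreover have "g \<tau> a = a" using root fixpoint_iff by blast
  ultimately have "((\<lambda>t. g t a) \<longlongrightarrow> a) (nhds \<tau>)"
    by (metis (mono_tags, lifting) isCont_def tendsto_at_iff_tendsto_nhds)
  then have "\<forall>\<^sub>F t in nhds \<tau>. dist (g t a) a < r / 2"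
    by (rule tendstoD) (use r in simp)
  moreover have "\<forall>\<^sub>F t in nhds \<tau>. t \<in> S" using S by (rule eventually_nhds_in_open)
  ultimately have "\<forall>\<^sub>F t in nhds \<tau>. dist (g t a) a < r / 2 \<and> t \<in> S"
    by (rule eventually_conj)
  then obtain d' where d': "d' > 0" "\<And>t. dist t \<tau> < d' \<Longrightarrow> dist (g t a) a < r / 2 \<and> t \<in> S"
    unfolding eventually_nhds_metric by blast
  define d where "d = min d' r"
  have d: "d > 0" and dr: "\<And>t. t \<in> ball \<tau> d \<Longrightarrow> dist t \<tau> < r"
    and dg: "\<And>t. t \<in> ball \<tau> d \<Longrightarrow> dist (g t a) a < r / 2"
    and dS: "ball \<tau> d \<subseteq> S"
    using d' r by (auto simp: d_def dist_commute)
  have self_map: "g t z \<in> cball a r" if t: "t \<in> ball \<tau> d" and z: "z \<in> cball a r" for t z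
  proof -
    have "dist (g t z) a \<le> dist (g t z) (g t a) + dist (g t a) a" by (rule dist_triangle)
    also have "dist (g t z) (g t a) \<le> 1/2 * dist z a"
      by (rule contraction[OF dr[OF t] z]) (use r in auto)
    also have "\<dots> \<le> r / 2" using z by (simp add: dist_commute)
    finally show ?thesis using dg[OF t] by (simp add: dist_commute)
  qed
  have "\<exists>!z. z \<in> cball a r \<and> g t z = z" if t: "t \<in> ball \<tau> d" for t
  proof (rule Banach_fix[of "cball a r" "1/2"])
    show "complete (cball a r)" by (simp add: compact_imp_complete)
    show "g t ` cball a r \<subseteq> cball a r" using self_map[OF t] by blast
    show "dist (g t z) (g t w) \<le> 1/2 * dist z w" if "z \<in> cball a r" "w \<in> cball a r" for z w
      by (rule contraction[OF dr[OF t] that])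
  qed (use r in auto)
  then obtain l where l: "\<And>t. t \<in> ball \<tau> d \<Longrightarrow> l t \<in> cball a r \<and> g t (l t) = l t"
    and l_unique: "\<And>t z. t \<in> ball \<tau> d \<Longrightarrow> z \<in> cball a r \<Longrightarrow> g t z = z \<Longrightarrow> z = l t"
    by metis

  \<comment> \<open>Every iterate is holomorphic in \<open>t\<close>, and the geometric rate does not depend on \<open>t\<close>.\<close>
  define u where "u k t = (g t ^^ k) a" for k t
  have u_Suc: "u (Suc k) t = g t (u k t)" for k t by (simp add: u_def)
  have u_hol: "u k holomorphic_on ball \<tau> d" for k
  proof (induction k)
    case (Suc k)
    then show ?case
      unfolding u_Suc g_def using c
      by (intro holomorphic_intros holomorphic_on_poly_compose[OF P _ dS]) auto
  qed (simp add: u_def)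
  have u_rate: "u k t \<in> cball a r \<and> dist (u k t) (l t) \<le> r * (1/2) ^ k"
    if t: "t \<in> ball \<tau> d" for k t
  proof (induction k)
    case 0
    then show ?case using l[OF t] r by (simp add: u_def)
  next
    case (Suc k)
    have "dist (u (Suc k) t) (l t) = dist (g t (u k t)) (g t (l t))"
      using l[OF t] by (simp add: u_Suc)
    also have "\<dots> \<le> 1/2 * dist (u k t) (l t)"
      using contraction[OF dr[OF t]] l[OF t] Suc by blast
    also have "\<dots> \<le> r * (1/2) ^ Suc k" using Suc by simp
    finally show ?case using self_map[OF t] Suc by (simp add: u_Suc)
  qed
  have limit: "uniform_limit (ball \<tau> d) u l sequentially"
  proof (rule uniform_limitI)
    fix \<epsilon> :: real assume "\<epsilon> > 0"
    have "(\<lambda>k. r * (1/2) ^ k) \<longlonglongrightarrow> r * 0"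
      by (intro tendsto_intros LIMSEQ_power_zero) auto
    then have "\<forall>\<^sub>F k in sequentially. r * (1/2) ^ k < \<epsilon>"
      using \<open>\<epsilon> > 0\<close> by (auto dest: order_tendstoD)
    then show "\<forall>\<^sub>F k in sequentially. \<forall>t\<in>ball \<tau> d. dist (u k t) (l t) < \<epsilon>"
      by (rule eventually_mono) (use u_rate in \<open>meson le_less_trans\<close>)
  qed
  have l_hol: "l holomorphic_on ball \<tau> d"
  proof (rule holomorphic_uniform_sequence[OF open_ball u_hol])
    fix t assume "t \<in> ball \<tau> d"
    then obtain \<delta> where "\<delta> > 0" "cball t \<delta> \<subseteq> ball \<tau> d"
      using open_ball open_contains_cball by blast
    then show "\<exists>\<delta>>0. cball t \<delta> \<subseteq> ball \<tau> d \<and> uniform_limit (cball t \<delta>) u l sequentially"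
      using uniform_limit_on_subset[OF limit] by blast
  qed
  show ?thesis
  proof (rule that[OF d r dS l_hol])
    show "l \<tau> = a" using l_unique[of \<tau> a] d r root fixpoint_iff by auto
    show "poly (P t) (l t) = 0" if "t \<in> ball \<tau> d" for t
      using l[OF that] fixpoint_iff by blast
    show "z = l t" if "t \<in> ball \<tau> d" "z \<in> cball a r" "poly (P t) z = 0" for t z
      using l_unique that fixpoint_iff by blast
  qed
qed

section \<open>The characteristic matrix and its adjugate\<close>

lemma char_poly_matrix_entry:
  assumes "A \<in> carrier_mat n n" "i < n" "j < n"
  shows "char_poly_matrix A $$ (i, j) = (if i = j then [:0, 1:] else 0) + [:- (A $$ (i, j)):]"
  using assms unfolding char_poly_matrix_def by auto

lemma holomorphic_poly_on_char_poly_matrix: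
  assumes carrier: "\<And>t. t \<in> S \<Longrightarrow> A t \<in> carrier_mat n n"
    and entries: "\<And>i j. i < n \<Longrightarrow> j < n \<Longrightarrow> (\<lambda>t. A t $$ (i, j)) holomorphic_on S"
    and ij: "i < n" "j < n"
  shows "holomorphic_poly_on (\<lambda>t. char_poly_matrix (A t) $$ (i, j)) S"
  by (subst holomorphic_poly_on_cong[OF char_poly_matrix_entry[OF carrier ij]])
     (auto simp only: intro!: holomorphic_poly_on_add holomorphic_poly_on_const
        holomorphic_poly_on_const_poly holomorphic_intros entries ij)

lemma simple_root_pderiv_nonzero:
  fixes p :: "complex poly"
  assumes "p \<noteq> 0" "order a p = 1"
  shows "poly (pderiv p) a \<noteq> 0"
proof -
  have root: "poly p a = 0" using assms by (simp add: order_root)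
  have "pderiv p \<noteq> 0"
  proof
    assume "pderiv p = 0"
    then obtain h where "p = [:h:]" using pderiv_iszero by blast
    then show False using root assms(1) by simp
  qed
  moreover have "order a (pderiv p) = 0"
    using order_pderiv[OF assms(1) root] assms(2) by simp
  ultimately show ?thesis by (simp add: order_root)
qed

text \<open>Entry \<open>j\<close> of \<open>adj (z I - A) x\<close>, as a polynomial in \<open>z\<close>. Staying in the polynomial
  ring allows the factor \<open>z - k\<close> to be handled by differentiation where evaluation at \<open>k\<close>
  would only give \<open>0 = 0\<close>.\<close>
definition adj_char_poly_vec :: "'a :: comm_ring_1 mat \<Rightarrow> 'a vec \<Rightarrow> nat \<Rightarrow> 'a poly" where
  "adj_char_poly_vec A x j =
     (\<Sum>k<dim_row A. adj_mat (char_poly_matrix A) $$ (j, k) * [:x $ k:])"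

lemma mat_mult_index_sum:
  assumes "A \<in> carrier_mat n n" "B \<in> carrier_mat n n" "i < n" "j < n"
  shows "(A * B) $$ (i, j) = (\<Sum>k<n. A $$ (i, k) * B $$ (k, j))"
  using assms by (auto simp: scalar_prod_def lessThan_atLeast0 intro!: sum.cong)

text \<open>This is \<open>M (adj M x) = (det M) x\<close> for \<open>M = z I - A\<close>. At a root of the characteristic
  polynomial it makes \<open>adj M x\<close> a vector in the kernel of \<open>M\<close>.\<close>

lemma char_poly_matrix_mult_adj_char_poly_vec:
  assumes A: "A \<in> carrier_mat n n" and i: "i < n"
  shows "(\<Sum>j<n. char_poly_matrix A $$ (i, j) * adj_char_poly_vec A x j) = char_poly A * [:x $ i:]"
proof -
  let ?C = "char_poly_matrix A"
  have C: "?C \<in> carrier_mat n n" using A by simp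
  have "(\<Sum>j<n. ?C $$ (i, j) * adj_char_poly_vec A x j)
      = (\<Sum>j<n. \<Sum>k<n. ?C $$ (i, j) * adj_mat ?C $$ (j, k) * [:x $ k:])"
    using A by (simp add: adj_char_poly_vec_def sum_distrib_left mult.assoc)
  also have "\<dots> = (\<Sum>k<n. \<Sum>j<n. ?C $$ (i, j) * adj_mat ?C $$ (j, k) * [:x $ k:])"
    by (rule sum.swap)
  also have "\<dots> = (\<Sum>k<n. (?C * adj_mat ?C) $$ (i, k) * [:x $ k:])"
    by (intro sum.cong refl)
       (simp only: mat_mult_index_sum[OF C adj_mat(1)[OF C] i] lessThan_iff sum_distrib_right)
  also have "\<dots> = (\<Sum>k<n. if k = i then char_poly A * [:x $ i:] else 0)"
    unfolding adj_mat(2)[OF C] by (intro sum.cong refl) (use i in \<open>auto simp: char_poly_def\<close>)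
  also have "\<dots> = char_poly A * [:x $ i:]" using i by simp
  finally show ?thesis .
qed

text \<open>Since \<open>(z I - A) x = (z - k) x\<close>, applying the adjugate gives
  \<open>(z - k) adj (z I - A) x = p(z) x\<close> with \<open>p\<close> the characteristic polynomial. Differentiating
  at \<open>z = k\<close> removes the factor \<open>z - k\<close>. If \<open>k\<close> is a simple root, the adjugate therefore
  sends \<open>x\<close> to a nonzero multiple of itself.\<close>

lemma adj_char_poly_vec_eigenvector:
  fixes A :: "'a :: field mat"
  assumes A: "A \<in> carrier_mat n n" and x: "eigenvector A x k" and j: "j < n"
  shows "poly (adj_char_poly_vec A x j) k = poly (pderiv (char_poly A)) k * x $ j"
proof -
  let ?C = "char_poly_matrix A"
  have C: "?C \<in> carrier_mat n n" using A by simp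
  have xn: "x \<in> carrier_vec n" and Ax: "A *\<^sub>v x = k \<cdot>\<^sub>v x"
    using x A unfolding eigenvector_def by auto
  have Cx: "(\<Sum>i<n. ?C $$ (m, i) * [:x $ i:]) = [:-k, 1:] * [:x $ m:]" if m: "m < n" for m
  proof -
    have "(\<Sum>i<n. A $$ (m, i) * x $ i) = (A *\<^sub>v x) $ m"
      using A xn m by (auto simp: scalar_prod_def lessThan_atLeast0 intro!: sum.cong)
    also have "\<dots> = k * x $ m" using Ax xn m by simp
    finally have row: "(\<Sum>i<n. A $$ (m, i) * x $ i) = k * x $ m" .
    have "(\<Sum>i<n. ?C $$ (m, i) * [:x $ i:])
        = (\<Sum>i<n. (if i = m then [:0, 1:] * [:x $ m:] else 0) + [:- (A $$ (m, i) * x $ i):])"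
      by (intro sum.cong refl) (auto simp: char_poly_matrix_entry[OF A m])
    also have "\<dots> = [:0, 1:] * [:x $ m:] + (\<Sum>i<n. [:- (A $$ (m, i) * x $ i):])"
      using m by (simp add: sum.distrib)
    also have "(\<Sum>i<n. [:- (A $$ (m, i) * x $ i):]) = [:- (k * x $ m):]"
      unfolding row[symmetric] by (simp add: sum_negf[symmetric] flip: sum_to_poly)
    finally show ?thesis by simp
  qed
  have "[:-k, 1:] * adj_char_poly_vec A x j
      = (\<Sum>m<n. adj_mat ?C $$ (j, m) * ([:-k, 1:] * [:x $ m:]))"
    using A
    by (simp add: adj_char_poly_vec_def sum_distrib_left mult.left_commute
          del: mult_pCons_left mult_pCons_right)
  also have "\<dots> = (\<Sum>m<n. \<Sum>i<n. adj_mat ?C $$ (j, m) * ?C $$ (m, i) * [:x $ i:])"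
    by (intro sum.cong refl) (simp only: Cx[symmetric] lessThan_iff sum_distrib_left mult.assoc)
  also have "\<dots> = (\<Sum>i<n. \<Sum>m<n. adj_mat ?C $$ (j, m) * ?C $$ (m, i) * [:x $ i:])"
    by (rule sum.swap)
  also have "\<dots> = (\<Sum>i<n. (adj_mat ?C * ?C) $$ (j, i) * [:x $ i:])"
    by (intro sum.cong refl)
       (simp only: mat_mult_index_sum[OF adj_mat(1)[OF C] C j] lessThan_iff sum_distrib_right)
  also have "\<dots> = (\<Sum>i<n. if i = j then char_poly A * [:x $ j:] else 0)"
    unfolding adj_mat(3)[OF C] by (intro sum.cong refl) (use j in \<open>auto simp: char_poly_def\<close>)
  also have "\<dots> = char_poly A * [:x $ j:]" using j by simp
  finally have "pderiv ([:-k, 1:] * adj_char_poly_vec A x j) = pderiv (char_poly A * [:x $ j:])"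
    by (rule arg_cong)
  then have "poly (pderiv ([:-k, 1:] * adj_char_poly_vec A x j)) k
      = poly (pderiv (char_poly A * [:x $ j:])) k"
    by (rule arg_cong)
  then show ?thesis
    by (simp add: pderiv_mult pderiv_pCons mult.commute del: mult_pCons_left mult_pCons_right)
qed

lemma left_eigenvector_column:
  assumes A: "A \<in> carrier_mat n n" and y: "left_eigenvector A y k" and j: "j < n"
  shows "(\<Sum>i<n. cnj (y $ i) * A $$ (i, j)) = k * cnj (y $ j)"
proof -
  have yn: "y \<in> carrier_vec n"
    and eq: "mat_of_row (conjugate y) * A = k \<cdot>\<^sub>m mat_of_row (conjugate y)"
    using y A unfolding left_eigenvector_def by auto
  have "(mat_of_row (conjugate y) * A) $$ (0, j) = (\<Sum>i<n. cnj (y $ i) * A $$ (i, j))"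
    using A yn j by (auto simp: scalar_prod_def lessThan_atLeast0 intro!: sum.cong)
  moreover have "(k \<cdot>\<^sub>m mat_of_row (conjugate y)) $$ (0, j) = k * cnj (y $ j)"
    using yn j by auto
  ultimately show ?thesis using eq by simp
qed

section \<open>The derivative of the eigenvalue\<close>

text \<open>Below, \<open>v j t\<close> and \<open>w j t\<close> are the entries of the row \<open>y\<^sup>* (l t I - A t)\<close> and of the
  column \<open>adj (l t I - A t) x\<close>. Their product is zero for all \<open>t\<close>, and at \<open>\<tau>\<close> the row vanishes,
  so only the derivative of the row contributes to the product rule.\<close>

lemma eigenvalue_deriv:
  assumes A: "\<And>t. t \<in> V \<Longrightarrow> A t \<in> carrier_mat n n"
    and entries: "\<And>i j. i < n \<Longrightarrow> j < n \<Longrightarrow> (\<lambda>t. A t $$ (i, j)) holomorphic_on V"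
    and V: "open V" "\<tau> \<in> V"
    and l: "l holomorphic_on V" "\<And>t. t \<in> V \<Longrightarrow> poly (char_poly (A t)) (l t) = 0"
    and simple: "poly (pderiv (char_poly (A \<tau>))) (l \<tau>) \<noteq> 0"
    and x: "eigenvector (A \<tau>) x (l \<tau>)" and y: "left_eigenvector (A \<tau>) y (l \<tau>)"
  shows "deriv l \<tau> * (x \<bullet>c y) = (mat_deriv A \<tau> *\<^sub>v x) \<bullet>c y"
proof -
  define v where "v j t = cnj (y $ j) * l t - (\<Sum>i<n. cnj (y $ i) * A t $$ (i, j))" for j t
  define w where "w j t = poly (adj_char_poly_vec (A t) x j) (l t)" for j t
  define v' where "v' j = cnj (y $ j) * deriv l \<tau>
      - (\<Sum>i<n. cnj (y $ i) * deriv (\<lambda>t. A t $$ (i, j)) \<tau>)" for j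
  have carrier: "x \<in> carrier_vec n" "y \<in> carrier_vec n"
    using x y A[OF V(2)] unfolding eigenvector_def left_eigenvector_def by auto
  have v_eq: "v j t = (\<Sum>i<n. cnj (y $ i) * poly (char_poly_matrix (A t) $$ (i, j)) (l t))"
    if "t \<in> V" "j < n" for t j
  proof -
    have "(\<Sum>i<n. cnj (y $ i) * poly (char_poly_matrix (A t) $$ (i, j)) (l t))
        = (\<Sum>i<n. (if i = j then cnj (y $ j) * l t else 0) - cnj (y $ i) * A t $$ (i, j))"
      by (intro sum.cong refl)
         (auto simp: char_poly_matrix_entry[OF A[OF that(1)]] that algebra_simps)
    also have "\<dots> = v j t" using that by (simp add: sum_subtractf v_def)
    finally show ?thesis ..
  qed
  have vanish: "(\<Sum>j<n. v j t * w j t) = 0" if t: "t \<in> V" for t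
  proof -
    let ?C = "\<lambda>i j. poly (char_poly_matrix (A t) $$ (i, j)) (l t)"
    have "(\<Sum>j<n. v j t * w j t) = (\<Sum>j<n. \<Sum>i<n. cnj (y $ i) * (?C i j * w j t))"
      by (intro sum.cong refl) (simp add: v_eq[OF t] sum_distrib_right mult.assoc)
    also have "\<dots> = (\<Sum>i<n. cnj (y $ i) * (\<Sum>j<n. ?C i j * w j t))"
      by (subst sum.swap) (simp add: sum_distrib_left)
    also have "\<dots> = (\<Sum>i<n. cnj (y $ i) * (poly (char_poly (A t) * [:x $ i:]) (l t)))"
    proof (intro sum.cong refl arg_cong2[where f = "(*)"])
      fix i assume "i \<in> {..<n}"
      then have i: "i < n" by simp
      show "(\<Sum>j<n. ?C i j * w j t) = poly (char_poly (A t) * [:x $ i:]) (l t)"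
        unfolding char_poly_matrix_mult_adj_char_poly_vec[OF A[OF t] i, symmetric]
        by (simp add: w_def poly_sum)
    qed
    also have "\<dots> = 0" using l(2)[OF t] by simp
    finally show ?thesis .
  qed
  have v_deriv: "(v j has_field_derivative v' j) (at \<tau>)" if "j < n" for j
    unfolding v_def[abs_def] v'_def using V that
    by (auto intro!: derivative_eq_intros sum.cong
          holomorphic_derivI[OF l(1)] holomorphic_derivI[OF entries])
  have w_deriv: "(w j has_field_derivative deriv (w j) \<tau>) (at \<tau>)" if j: "j < n" for j
  proof -
    have "holomorphic_poly_on (\<lambda>t. \<Sum>k<n. adj_mat (char_poly_matrix (A t)) $$ (j, k) * [:x $ k:]) V"
      by (intro holomorphic_poly_on_sum holomorphic_poly_on_mult holomorphic_poly_on_const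
            holomorphic_poly_on_adj_mat[where n = n] char_poly_matrix_closed
            holomorphic_poly_on_char_poly_matrix[where n = n] A entries) (use j in auto)
    moreover have "adj_char_poly_vec (A t) x j
        = (\<Sum>k<n. adj_mat (char_poly_matrix (A t)) $$ (j, k) * [:x $ k:])" if "t \<in> V" for t
      using A[OF that] by (simp add: adj_char_poly_vec_def)
    ultimately have "holomorphic_poly_on (\<lambda>t. adj_char_poly_vec (A t) x j) V"
      by (subst holomorphic_poly_on_cong)
    then have "w j holomorphic_on V"
      unfolding w_def[abs_def] by (rule holomorphic_on_poly_compose[OF _ l(1)]) auto
    then show ?thesis using V by (rule holomorphic_derivI)
  qed
  have v0: "v j \<tau> = 0" if "j < n" for j
    using left_eigenvector_column[OF A[OF V(2)] y that] by (simp add: v_def mult.commute)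
  have w0: "w j \<tau> = poly (pderiv (char_poly (A \<tau>))) (l \<tau>) * x $ j" if "j < n" for j
    unfolding w_def by (rule adj_char_poly_vec_eigenvector[OF A[OF V(2)] x that])
  have "((\<lambda>t. \<Sum>j<n. v j t * w j t) has_field_derivative
      (\<Sum>j<n. v' j * w j \<tau> + deriv (w j) \<tau> * v j \<tau>)) (at \<tau>)"
    by (intro DERIV_sum DERIV_mult v_deriv w_deriv) auto
  moreover have "((\<lambda>t. \<Sum>j<n. v j t * w j t) has_field_derivative 0) (at \<tau>)"
    by (rule has_field_derivative_transform_within_open[OF DERIV_const V]) (simp add: vanish)
  ultimately have "(\<Sum>j<n. v' j * w j \<tau> + deriv (w j) \<tau> * v j \<tau>) = 0"
    by (rule DERIV_unique)
  then have "poly (pderiv (char_poly (A \<tau>))) (l \<tau>) * (\<Sum>j<n. v' j * x $ j) = 0"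
    by (simp add: v0 w0 sum_distrib_left ac_simps)
  then have "(\<Sum>j<n. v' j * x $ j) = 0" using simple by simp
  moreover have "(\<Sum>j<n. v' j * x $ j) = deriv l \<tau> * (x \<bullet>c y) - (mat_deriv A \<tau> *\<^sub>v x) \<bullet>c y"
  proof -
    have "x \<bullet>c y = (\<Sum>j<n. x $ j * cnj (y $ j))"
      using carrier by (auto simp: scalar_prod_def lessThan_atLeast0 intro!: sum.cong)
    moreover have "(mat_deriv A \<tau> *\<^sub>v x) \<bullet>c y
        = (\<Sum>i<n. (\<Sum>j<n. deriv (\<lambda>t. A t $$ (i, j)) \<tau> * x $ j) * cnj (y $ i))"
      using carrier A[OF V(2)]
      by (auto simp: mat_deriv_def scalar_prod_def lessThan_atLeast0 intro!: sum.cong)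
    moreover have "\<dots> = (\<Sum>j<n. (\<Sum>i<n. cnj (y $ i) * deriv (\<lambda>t. A t $$ (i, j)) \<tau>) * x $ j)"
      unfolding sum_distrib_right by (subst sum.swap) (simp add: ac_simps)
    ultimately show ?thesis
      by (simp add: v'_def left_diff_distrib right_diff_distrib sum_subtractf sum_distrib_left ac_simps)
  qed
  ultimately show ?thesis by simp
qed

section \<open>Analytic continuation of a simple eigenvalue\<close>

theorem theorem1:
  fixes n :: nat and A0 :: "complex mat" and lambda0 tau0 :: complex
    and x0 y0 :: "complex vec" and A :: "complex \<Rightarrow> complex mat" and U :: "complex set"
  assumes "A0 \<in> carrier_mat n n"
    and "simple_eigenvalue A0 lambda0"
    and "eigenvector A0 x0 lambda0"
    and "left_eigenvector A0 y0 lambda0"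
    and "x0 \<bullet>c y0 = 1"
    and "open U" and "tau0 \<in> U"
    and "mat_analytic_on n A U"
    and "A tau0 = A0"
  shows "\<exists>V l. open V \<and> tau0 \<in> V \<and> V \<subseteq> U \<and>
           analytic_eigenvalue_on A V l \<and> l tau0 = lambda0 \<and>
           (\<forall>m. analytic_eigenvalue_on A V m \<and> m tau0 = lambda0 \<longrightarrow> (\<forall>t\<in>V. m t = l t)) \<and>
           deriv l tau0 = (mat_deriv A tau0 *\<^sub>v x0) \<bullet>c y0"
proof -
  let ?P = "\<lambda>t. char_poly (A t)"
  have carrier: "\<And>t. t \<in> U \<Longrightarrow> A t \<in> carrier_mat n n"
    and entries: "\<And>i j. i < n \<Longrightarrow> j < n \<Longrightarrow> (\<lambda>t. A t $$ (i, j)) holomorphic_on U"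
    using assms(8) unfolding mat_analytic_on_def by (auto dest: analytic_imp_holomorphic)
  have P: "holomorphic_poly_on ?P U"
    unfolding char_poly_def
    by (intro holomorphic_poly_on_det[where n = n] char_poly_matrix_closed
          holomorphic_poly_on_char_poly_matrix[where n = n] carrier entries)
  have nonzero: "?P tau0 \<noteq> 0"
    using degree_monic_char_poly[OF assms(1)] assms(9) by auto
  have root: "poly (?P tau0) lambda0 = 0"
    and simple: "poly (pderiv (?P tau0)) lambda0 \<noteq> 0"
    using assms(2,9) eigenvalue_root_char_poly[OF assms(1)]
      simple_root_pderiv_nonzero[OF nonzero]
    unfolding simple_eigenvalue_def by auto
  obtain d r l where d: "d > 0" and r: "r > 0" and dU: "ball tau0 d \<subseteq> U"
    and l: "l holomorphic_on ball tau0 d" "l tau0 = lambda0"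
      "\<And>t. t \<in> ball tau0 d \<Longrightarrow> poly (?P t) (l t) = 0"
    and local_unique: "\<And>t z. t \<in> ball tau0 d \<Longrightarrow> z \<in> cball lambda0 r \<Longrightarrow> poly (?P t) z = 0 \<Longrightarrow> z = l t"
    using holomorphic_simple_root[OF assms(6,7) P root simple] by blast
  let ?V = "ball tau0 d"
  have tau0: "tau0 \<in> ?V" using d by simp
  have eigenvalue_iff: "eigenvalue (A t) z \<longleftrightarrow> poly (?P t) z = 0" if "t \<in> ?V" for t z
    using eigenvalue_root_char_poly carrier dU that by blast
  have l_eig: "analytic_eigenvalue_on A ?V l"
    unfolding analytic_eigenvalue_on_def
    using l eigenvalue_iff by (simp add: analytic_on_open)
  have unique: "m t = l t"
    if m: "analytic_eigenvalue_on A ?V m" "m tau0 = lambda0" and t: "t \<in> ?V" for m t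
  proof -
    have m_hol: "m holomorphic_on ?V" and m_eig: "\<And>t. t \<in> ?V \<Longrightarrow> eigenvalue (A t) (m t)"
      using m unfolding analytic_eigenvalue_on_def by (auto simp: analytic_on_open)
    \<comment> \<open>Near \<open>tau0\<close> the values of \<open>m\<close> lie in the disc where \<open>l\<close> is the only root.\<close>
    define W where "W = ?V \<inter> m -` ball lambda0 r"
    have "open W"
      unfolding W_def using m_hol
      by (intro continuous_open_preimage holomorphic_on_imp_continuous_on) auto
    moreover have "tau0 \<in> W" using tau0 m(2) r by (simp add: W_def)
    ultimately have "tau0 islimpt W" by (simp add: interior_limit_point interior_open)
    moreover have "m z - l z = 0" if "z \<in> W" for z
      using that local_unique[of z "m z"] m_eig[of z] eigenvalue_iff[of z "m z"]
      by (auto simp: W_def)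
    ultimately have "m t - l t = 0"
      using analytic_continuation[of "\<lambda>z. m z - l z" ?V W tau0 t] m_hol l(1) tau0 t
      by (auto intro: holomorphic_intros simp: W_def)
    then show ?thesis by simp
  qed
  have "deriv l tau0 * (x0 \<bullet>c y0) = (mat_deriv A tau0 *\<^sub>v x0) \<bullet>c y0"
    by (rule eigenvalue_deriv[where V = ?V and n = n])
       (use carrier entries dU tau0 l simple assms(3,4,9) in \<open>auto intro: holomorphic_on_subset\<close>)
  then have "deriv l tau0 = (mat_deriv A tau0 *\<^sub>v x0) \<bullet>c y0"
    using assms(5) by simp
  then show ?thesis
    using open_ball tau0 dU l_eig l(2) unique by blast
qed

end
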